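(* Let $n \ge 1$ and let $X \in \mathbb{M}_n$ be generic, in the sense that $\sigma(2X^2) \cap \sigma(-3X - 5I) = \emptyset$. Then every $Y \in \mathbb{M}_n$ satisfying $$X^3 + 2X^2Y + 3YX + 4X + 5Y + 6I = 0$$ commutes with $X$, i.e. $XY = YX$.
   Context: $\mathbb{M}_n$ denotes the algebra of $n$-by-$n$ complex matrices, $I$ is the $n$-by-$n$ identity matrix, and $\sigma(A)$ denotes the spectrum (set of eigenvalues) of $A \in \mathbb{M}_n$. *)

theory Defs
  imports "Jordan_Normal_Form.Spectral_Radius"
begin

end

theory Submission
  imports Defs
begin

text \<open>
  Put \<open>A = 2 X\<^sup>2\<close> and \<open>B = - 3 X - 5 I\<close>. The cubic equation says
  \<open>A Y - Y B = - (X\<^sup>3 + 4 X + 6 I)\<close>: it is a Sylvester equation in \<open>Y\<close> whose coefficients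
  and right-hand side are all polynomials in \<open>X\<close>. The Sylvester operator
  \<open>Z \<mapsto> A Z - Z B\<close> therefore commutes with the derivation \<open>Z \<mapsto> X Z - Z X\<close>, and applying
  this derivation to the equation shows that the commutator \<open>X Y - Y X\<close> lies in the kernel of
  the operator. Sylvester's theorem says that this kernel is trivial as soon as
  \<open>A\<close> and \<open>B\<close> have no common eigenvalue, which is the genericity hypothesis.

  Sylvester's theorem is \<open>sylvester_homogeneous_trivial\<close>; after a Schur decomposition of \<open>B\<close> its
  content is \<open>intertwiner_upper_triangular_zero\<close>. The transfer of commutation from the
  right-hand side to the solution is \<open>sylvester_solution_commutes\<close>.
\<close>

text \<open>
  Both sides of \<open>A W = W T\<close> are compared column by column. If all columns of \<open>W\<close> before the
  \<open>j\<close>-th vanish, then the \<open>j\<close>-th column of \<open>W T\<close> is \<open>T\<^sub>j\<^sub>j\<close> times that of \<open>W\<close>, so the \<open>j\<close>-th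
  column of \<open>W\<close> would be an eigenvector of \<open>A\<close> if it were not zero.
\<close>
lemma intertwiner_upper_triangular_zero:
  fixes A T W :: "'a :: field mat"
  assumes A: "A \<in> carrier_mat m m" and T: "T \<in> carrier_mat n n" and W: "W \<in> carrier_mat m n"
    and upper: "upper_triangular T"
    and intertwines: "A * W = W * T"
    and no_ev: "\<And>j. j < n \<Longrightarrow> \<not> eigenvalue A (T $$ (j, j))"
  shows "W = 0\<^sub>m m n"
proof -
  have col_zero: "j < n \<Longrightarrow> col W j = 0\<^sub>v m" for j
  proof (induction j rule: less_induct)
    case (less j)
    have "col (W * T) j = T $$ (j, j) \<cdot>\<^sub>v col W j"
    proof (rule eq_vecI)
      fix i assume "i < dim_vec (T $$ (j, j) \<cdot>\<^sub>v col W j)"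
      then have i: "i < m" using W by simp
      have off_diagonal: "W $$ (i, k) * T $$ (k, j) = 0" if k: "k < n" "k \<noteq> j" for k
      proof (cases "k < j")
        case True
        then have "col W k $ i = 0" using less k i by simp
        then show ?thesis using W i k by simp
      next
        case False
        then show ?thesis using upper_triangularD[OF upper, of j k] T k by simp
      qed
      have "col (W * T) j $ i = (\<Sum>k = 0..<n. W $$ (i, k) * T $$ (k, j))"
        using W T i less.prems by (simp add: scalar_prod_def)
      also have "\<dots> = (\<Sum>k \<in> {j}. W $$ (i, k) * T $$ (k, j))"
        by (rule sum.mono_neutral_right) (use off_diagonal less.prems in auto)
      finally show "col (W * T) j $ i = (T $$ (j, j) \<cdot>\<^sub>v col W j) $ i"
        using W i less.prems by simp
    qed (use W in simp)
    then have "A *\<^sub>v col W j = T $$ (j, j) \<cdot>\<^sub>v col W j"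
      using col_mult2[OF A W less.prems] intertwines by simp
    moreover have "col W j \<in> carrier_vec m" using W by (intro carrier_vecI) simp
    ultimately show ?case
      using no_ev[OF less.prems] A unfolding eigenvalue_def eigenvector_def by auto
  qed
  show ?thesis
  proof (rule eq_matI)
    fix i j assume ij: "i < dim_row (0\<^sub>m m n :: 'a mat)" "j < dim_col (0\<^sub>m m n :: 'a mat)"
    then have "col W j $ i = 0" using col_zero by simp
    then show "W $$ (i, j) = 0\<^sub>m m n $$ (i, j)" using ij W by simp
  qed (use W in auto)
qed

theorem sylvester_homogeneous_trivial:
  fixes A B Z :: "complex mat"
  assumes A: "A \<in> carrier_mat m m" and B: "B \<in> carrier_mat n n" and Z: "Z \<in> carrier_mat m n"
    and disjoint: "spectrum A \<inter> spectrum B = {}"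
    and intertwines: "A * Z = Z * B"
  shows "Z = 0\<^sub>m m n"
proof -
  obtain es where "char_poly B = (\<Prod>a \<leftarrow> es. [:- a, 1:])"
    using char_poly_factorized[OF B] by blast
  then obtain T where T: "T \<in> carrier_mat n n" and upper: "upper_triangular T"
    and sim: "similar_mat B T"
    using schur_decomposition_exists[OF B] by blast
  then obtain P Q where "similar_mat_wit B T P Q" unfolding similar_mat_def by blast
  note wit = similar_mat_witD2[OF B this]
  have P: "P \<in> carrier_mat n n" and Q: "Q \<in> carrier_mat n n" using wit by auto
  have PT: "P * T \<in> carrier_mat n n" using P T by simp
  have "B * P = P * T * (Q * P)"
    unfolding wit(3) by (rule assoc_mult_mat[OF PT Q P])
  then have BP: "B * P = P * T" using right_mult_one_mat[OF PT] wit(2) by simp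
  have "A * (Z * P) = A * Z * P" using assoc_mult_mat[OF A Z P] by simp
  also have "\<dots> = Z * (B * P)" unfolding intertwines by (rule assoc_mult_mat[OF Z B P])
  also have "\<dots> = Z * P * T" unfolding BP using assoc_mult_mat[OF Z P T] by simp
  finally have "A * (Z * P) = Z * P * T" .
  moreover have "\<not> eigenvalue A (T $$ (j, j))" if "j < n" for j
  proof -
    have "T $$ (j, j) \<in> set (diag_mat T)" using that T by (auto simp: diag_mat_def)
    then have "poly (char_poly B) (T $$ (j, j)) = 0"
      unfolding char_poly_similar[OF sim] char_poly_upper_triangular[OF T upper]
      by (force simp: poly_prod_list prod_list_zero_iff)
    then show ?thesis
      using disjoint eigenvalue_root_char_poly[OF B] by (auto simp: spectrum_def)
  qed
  ultimately have ZP: "Z * P = 0\<^sub>m m n"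
    using intertwiner_upper_triangular_zero[OF A T _ upper] Z P by simp
  have "Z = Z * (P * Q)" using wit(1) Z by simp
  also have "\<dots> = Z * P * Q" using assoc_mult_mat[OF Z P Q] by simp
  also have "\<dots> = 0\<^sub>m m n" unfolding ZP using Q by simp
  finally show ?thesis .
qed

text \<open>
  For \<open>X\<close> commuting with \<open>A\<close> and \<open>B\<close>, the commutator \<open>Z = X Y - Y X\<close> satisfies
  \<open>A Z - Z B = X (A Y - Y B) - (A Y - Y B) X\<close>, and the right-hand side vanishes.
\<close>
lemma sylvester_solution_commutes:
  fixes A B X Y :: "complex mat"
  assumes A: "A \<in> carrier_mat n n" and B: "B \<in> carrier_mat n n"
    and X: "X \<in> carrier_mat n n" and Y: "Y \<in> carrier_mat n n"
    and AX: "A * X = X * A" and BX: "B * X = X * B"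
    and rhs_commutes: "X * (A * Y - Y * B) = (A * Y - Y * B) * X"
    and disjoint: "spectrum A \<inter> spectrum B = {}"
  shows "X * Y = Y * X"
proof -
  note [simp] = A B X Y mult_carrier_mat[of _ n n _ n]
  note assoc = assoc_mult_mat[of _ n n _ n _ n]
  have XAY: "X * (A * Y) = A * (X * Y)"
    using AX assoc[of X A Y] assoc[of A X Y] by simp
  have YBX: "Y * B * X = Y * X * B"
    using BX assoc[of Y B X] assoc[of Y X B] by simp
  have "A * (X * Y) - X * (Y * B) = X * (A * Y - Y * B)"
    using mult_minus_distrib_mat[of X n n "A * Y" n "Y * B"] XAY by simp
  also have "\<dots> = A * Y * X - Y * B * X"
    unfolding rhs_commutes by (rule minus_mult_distrib_mat[of _ n n _ _ n]) simp_all
  also have "\<dots> = A * (Y * X) - Y * X * B" using YBX assoc[of A Y X] by simp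
  finally have eq: "A * (X * Y) - X * (Y * B) = A * (Y * X) - Y * X * B" .
  have AZ: "A * (X * Y - Y * X) = A * (X * Y) - A * (Y * X)"
    by (rule mult_minus_distrib_mat[of _ n n _ n]) simp_all
  have ZB: "(X * Y - Y * X) * B = X * (Y * B) - Y * X * B"
    using minus_mult_distrib_mat[of "X * Y" n n "Y * X" B n] assoc[of X Y B] by simp
  have rearrange: "U - S = V - R" if "U - V = S - R"
    and "U \<in> carrier_mat n n" "V \<in> carrier_mat n n" "S \<in> carrier_mat n n" "R \<in> carrier_mat n n"
    for U V S R :: "complex mat"
  proof (rule eq_matI)
    fix i j assume ij: "i < dim_row (V - R)" "j < dim_col (V - R)"
    have "(U - V) $$ (i, j) = (S - R) $$ (i, j)" using that(1) by simp
    then show "(U - S) $$ (i, j) = (V - R) $$ (i, j)"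
      using ij that(2-5) by (simp add: algebra_simps)
  qed (use that(2-5) in auto)
  have "A * (X * Y - Y * X) = (X * Y - Y * X) * B"
    unfolding AZ ZB by (rule rearrange[OF eq]) simp_all
  then have Z: "X * Y - Y * X = 0\<^sub>m n n"
    by (intro sylvester_homogeneous_trivial[OF A B _ disjoint]) (simp_all add: minus_carrier_mat)
  show ?thesis
  proof (rule eq_matI)
    fix i j assume ij: "i < dim_row (Y * X)" "j < dim_col (Y * X)"
    have "(X * Y - Y * X) $$ (i, j) = 0" unfolding Z using ij X Y by simp
    then show "(X * Y) $$ (i, j) = (Y * X) $$ (i, j)" using ij by simp
  qed (simp_all add: carrier_matD[OF X] carrier_matD[OF Y])
qed

lemma pow_mat_commutes:
  fixes X :: "'a :: semiring_1 mat"
  assumes X: "X \<in> carrier_mat n n"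
  shows "X ^\<^sub>m k * X = X * X ^\<^sub>m k"
proof (induction k)
  case (Suc k)
  have "X * (X ^\<^sub>m k * X) = X * X ^\<^sub>m k * X"
    using assoc_mult_mat[OF X pow_carrier_mat[OF X] X] by simp
  then show ?case using Suc by simp
qed (use X in simp)

theorem proposition1p6:
  fixes n :: nat and X :: "complex mat"
  assumes "n \<ge> 1"
    and "X \<in> carrier_mat n n"
    and "spectrum (2 \<cdot>\<^sub>m (X ^\<^sub>m 2)) \<inter> spectrum ((-3) \<cdot>\<^sub>m X - 5 \<cdot>\<^sub>m 1\<^sub>m n) = {}"
  shows "\<forall>Y \<in> carrier_mat n n.
           X ^\<^sub>m 3 + 2 \<cdot>\<^sub>m (X ^\<^sub>m 2 * Y) + 3 \<cdot>\<^sub>m (Y * X) + 4 \<cdot>\<^sub>m X + 5 \<cdot>\<^sub>m Y + 6 \<cdot>\<^sub>m 1\<^sub>m n = 0\<^sub>m n n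
           \<longrightarrow> X * Y = Y * X"
proof (intro ballI impI)
  fix Y :: "complex mat"
  assume Y: "Y \<in> carrier_mat n n"
  assume cubic:
    "X ^\<^sub>m 3 + 2 \<cdot>\<^sub>m (X ^\<^sub>m 2 * Y) + 3 \<cdot>\<^sub>m (Y * X) + 4 \<cdot>\<^sub>m X + 5 \<cdot>\<^sub>m Y + 6 \<cdot>\<^sub>m 1\<^sub>m n = 0\<^sub>m n n"
  note X = \<open>X \<in> carrier_mat n n\<close>
  have pow [simp]: "X ^\<^sub>m k \<in> carrier_mat n n" for k by (rule pow_carrier_mat[OF X])
  note [simp] = X Y
  let ?A = "2 \<cdot>\<^sub>m (X ^\<^sub>m 2)" and ?B = "(-3) \<cdot>\<^sub>m X - 5 \<cdot>\<^sub>m 1\<^sub>m n"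
  let ?R = "(-1) \<cdot>\<^sub>m (X ^\<^sub>m 3) + (-4) \<cdot>\<^sub>m X + (-6) \<cdot>\<^sub>m 1\<^sub>m n"
  note smult_simps = mult_smult_distrib[of _ n n _ n] mult_smult_assoc_mat[of _ n n _ n]
  have AX: "?A * X = X * ?A"
    by (simp add: smult_simps pow_mat_commutes[OF X])
  have BX: "?B * X = X * ?B"
    using minus_mult_distrib_mat[of "(-3) \<cdot>\<^sub>m X" n n "5 \<cdot>\<^sub>m 1\<^sub>m n" X n]
      mult_minus_distrib_mat[of X n n "(-3) \<cdot>\<^sub>m X" n "5 \<cdot>\<^sub>m 1\<^sub>m n"]
    by (simp add: smult_simps left_mult_one_mat[OF X] right_mult_one_mat[OF X])
  have RX: "X * ?R = ?R * X"
    by (simp add: mult_add_distrib_mat[of _ n n _ n] add_mult_distrib_mat[of _ n n _ _ n]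
        smult_simps pow_mat_commutes[OF X] left_mult_one_mat[OF X] right_mult_one_mat[OF X])
  have YB: "Y * ?B = (-3) \<cdot>\<^sub>m (Y * X) - 5 \<cdot>\<^sub>m Y"
    using mult_minus_distrib_mat[of Y n n "(-3) \<cdot>\<^sub>m X" n "5 \<cdot>\<^sub>m 1\<^sub>m n"]
    by (simp add: smult_simps right_mult_one_mat[OF Y])
  have AY: "?A * Y = 2 \<cdot>\<^sub>m (X ^\<^sub>m 2 * Y)" by (simp add: smult_simps)
  have sylvester: "?A * Y - Y * ?B = ?R"
    unfolding YB AY
  proof (rule eq_matI)
    \<comment> \<open>Products and powers are made opaque, so that an entry of the cubic equation is a
      linear relation between the entries of its terms.\<close>
    define U V K where "U = X ^\<^sub>m 2 * Y" and "V = Y * X" and "K = X ^\<^sub>m 3"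
    have carr [simp]: "U \<in> carrier_mat n n" "V \<in> carrier_mat n n" "K \<in> carrier_mat n n"
      by (simp_all add: U_def V_def K_def mult_carrier_mat[of _ n n])
    fix i j assume "i < dim_row ?R" "j < dim_col ?R"
    then have ij: "i < n" "j < n" by auto
    have "(K + 2 \<cdot>\<^sub>m U + 3 \<cdot>\<^sub>m V + 4 \<cdot>\<^sub>m X + 5 \<cdot>\<^sub>m Y + 6 \<cdot>\<^sub>m 1\<^sub>m n) $$ (i, j) = 0"
      using cubic ij unfolding U_def V_def K_def by simp
    then have "K $$ (i, j) + 2 * U $$ (i, j) + 3 * V $$ (i, j) + 4 * X $$ (i, j)
        + 5 * Y $$ (i, j) + 6 * 1\<^sub>m n $$ (i, j) = 0"
      using ij carrier_matD[OF carr(1)] carrier_matD[OF carr(2)] carrier_matD[OF carr(3)]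
        carrier_matD[OF X] carrier_matD[OF Y] by (simp del: index_one_mat(1))
    then have "2 * U $$ (i, j) - ((-3) * V $$ (i, j) - 5 * Y $$ (i, j))
        = (-1) * K $$ (i, j) + (-4) * X $$ (i, j) + (-6) * 1\<^sub>m n $$ (i, j)"
      by (subst eq_iff_diff_eq_0) (simp add: algebra_simps del: index_one_mat(1))
    then have "(2 \<cdot>\<^sub>m U - ((-3) \<cdot>\<^sub>m V - 5 \<cdot>\<^sub>m Y)) $$ (i, j)
        = ((-1) \<cdot>\<^sub>m K + (-4) \<cdot>\<^sub>m X + (-6) \<cdot>\<^sub>m 1\<^sub>m n) $$ (i, j)"
      using ij carrier_matD[OF carr(1)] carrier_matD[OF carr(2)] carrier_matD[OF carr(3)]
        carrier_matD[OF X] carrier_matD[OF Y] by (simp del: index_one_mat(1))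
    then show "(2 \<cdot>\<^sub>m (X ^\<^sub>m 2 * Y) - ((-3) \<cdot>\<^sub>m (Y * X) - 5 \<cdot>\<^sub>m Y)) $$ (i, j) = ?R $$ (i, j)"
      unfolding U_def V_def K_def .
  qed (use carrier_matD[OF X] carrier_matD[OF Y] in auto)
  show "X * Y = Y * X"
  proof (rule sylvester_solution_commutes[OF _ _ X Y AX BX])
    show "X * (?A * Y - Y * ?B) = (?A * Y - Y * ?B) * X" unfolding sylvester by (rule RX)
  qed (use assms(3) in \<open>simp_all add: minus_carrier_mat\<close>)
qed

end
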